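(* Let $k\ge4$ be an even integer and let $L(x)=\frac1kx^k$. For any fixed learning rate $\eta>0$ and any $x_0\in\mathbb{R}$ with $x_0\neq0$, the solution $x(t)$ of the gradient flow $$\dot x=-\eta\nabla L(x)=-\eta x^{k-1},\qquad x(0)=x_0,$$ exhibits the asymptotic power-law decay $$x(t)=\Theta\!\left(t^{-\frac{1}{k-2}}\right)\quad\text{as }t\to\infty .$$
   Context: $x(t)=\Theta(f(t))$ as $t\to\infty$ (with $f>0$) means that there are constants $0<c\le C$ and $T>0$ with $c f(t)\le|x(t)|\le Cf(t)$ for all $t\ge T$. *)

theory Defs
  imports "HOL-Analysis.Analysis" "HOL-Library.Landau_Symbols"
begin

definition power_loss :: "nat \<Rightarrow> real \<Rightarrow> real" where
  "power_loss k x = x ^ k / real k"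

lemma deriv_power_loss:
  assumes "k > 0"
  shows "deriv (power_loss k) x = x ^ (k - 1)"
proof -
  have "(power_loss k has_field_derivative x ^ (k - 1)) (at x)"
    unfolding power_loss_def [abs_def] using assms
    by (auto intro!: derivative_eq_intros)
  then show ?thesis
    by (rule DERIV_imp_deriv)
qed

(* A global forward solution: only the values of x on [0, \<infinity>) matter, and the derivative
   at t = 0 is one-sided.  On the real line the gradient of L is its derivative;
   deriv L is unspecified where L is not differentiable, so this is meant for differentiable L. *)
definition gradient_flow_solution ::
  "real \<Rightarrow> (real \<Rightarrow> real) \<Rightarrow> real \<Rightarrow> (real \<Rightarrow> real) \<Rightarrow> bool" where
  "gradient_flow_solution \<eta> L x0 x \<longleftrightarrow>
     x 0 = x0 \<and>
     (\<forall>t\<ge>0. (x has_real_derivative - \<eta> * deriv L (x t)) (at t within {0..}))"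

end

theory Submission
  imports Defs "HOL-Real_Asymp.Real_Asymp"
begin

text \<open>
  Put \<open>m = k - 2\<close>. The power \<open>w = x ^ m\<close> solves the Riccati equation \<open>w' = - c w\<^sup>2\<close>
  with \<open>c = m \<eta>\<close>. The defect \<open>g t = w t * (1 + c * w 0 * t) - w 0\<close> satisfies \<open>g' = - c w g\<close>,
  and \<open>w \<ge> 0\<close> because \<open>m\<close> is even, so \<open>g\<^sup>2\<close> is nonincreasing; as \<open>g 0 = 0\<close>, \<open>g\<close> vanishes.
  Hence \<open>\<bar>x t\<bar> = (w 0 / (1 + c * w 0 * t)) powr (1 / m)\<close>, without first
  having to know that \<open>x\<close> has no zero.
\<close>

lemma riccati_solution_unique:
  fixes w :: "real \<Rightarrow> real"
  assumes deriv: "\<And>s. s \<ge> 0 \<Longrightarrow> (w has_real_derivative - c * (w s)\<^sup>2) (at s within {0..})"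
    and nonneg: "\<And>s. s \<ge> 0 \<Longrightarrow> w s \<ge> 0" and "c \<ge> 0" "t \<ge> 0"
  shows "w t = w 0 / (1 + c * w 0 * t)"
proof -
  define g where "g s = w s * (1 + c * w 0 * s) - w 0" for s
  \<comment> \<open>Squaring makes the sign of \<open>g\<close> irrelevant: monotonicity depends
    only on the sign of \<open>c * w s\<close>. The domain shrinks to \<open>{0..t}\<close>, where
    the mean value theorem is applied below.\<close>
  have g2: "((\<lambda>s. (g s)\<^sup>2) has_real_derivative - 2 * c * w s * (g s)\<^sup>2) (at s within {0..t})"
    if "s \<ge> 0" for s
  proof -
    have "(w has_real_derivative - c * (w s)\<^sup>2) (at s within {0..t})"
      using deriv[OF that] by (rule DERIV_subset) auto
    then show ?thesis
      unfolding g_def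
      by (auto intro!: derivative_eq_intros simp: power2_eq_square algebra_simps)
  qed
  obtain s where s: "s \<in> {0..t}" "(g t)\<^sup>2 - (g 0)\<^sup>2 = - 2 * c * w s * (g s)\<^sup>2 * t"
    using mvt_very_simple[OF \<open>t \<ge> 0\<close> g2[THEN has_field_derivative_imp_has_derivative]] by auto
  have "c * w s * (g s)\<^sup>2 * t \<ge> 0"
    using s(1) nonneg[of s] \<open>c \<ge> 0\<close> by simp
  with s(2) have "(g t)\<^sup>2 \<le> (g 0)\<^sup>2"
    by simp
  then have "g t = 0"
    by (simp add: g_def)
  moreover have "1 + c * w 0 * t > 0"
    using assms nonneg[of 0] by (intro add_pos_nonneg mult_nonneg_nonneg) auto
  ultimately show ?thesis
    by (simp add: g_def field_simps)
qed

lemma gradient_flow_power_loss_iff: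
  assumes "k > 0"
  shows "gradient_flow_solution \<eta> (power_loss k) x0 x \<longleftrightarrow>
    x 0 = x0 \<and> (\<forall>t\<ge>0. (x has_real_derivative - \<eta> * x t ^ (k - 1)) (at t within {0..}))"
  using assms by (simp add: gradient_flow_solution_def deriv_power_loss)

text \<open>Separation of variables gives this formula; the factor \<open>x0\<close> carries the
  sign. Since \<open>m\<close> is even, the base of \<open>powr\<close> stays positive for all
  \<open>t \<ge> 0\<close>, so there is no blow-up.\<close>

lemma gradient_flow_power_loss_exists:
  assumes "m > 0" "even m" "\<eta> \<ge> 0"
  shows "gradient_flow_solution \<eta> (power_loss (m + 2)) x0
    (\<lambda>t. x0 * (1 + m * \<eta> * x0 ^ m * t) powr (- 1 / m))"
proof -
  define b where "b = m * \<eta> * x0 ^ m"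
  have b: "b \<ge> 0"
    using assms by (simp add: b_def zero_le_even_power)
  have "((\<lambda>t. x0 * (1 + b * t) powr (- 1 / m)) has_real_derivative
      - \<eta> * (x0 * (1 + b * t) powr (- 1 / m)) ^ (m + 1)) (at t within {0..})"
    if "t \<ge> 0" for t
  proof -
    have pos: "1 + b * t > 0"
      using b that by (intro add_pos_nonneg mult_nonneg_nonneg) auto
    have "((1 + b * t) powr (- 1 / m)) ^ (m + 1) = (1 + b * t) powr (- 1 / m - 1)"
    proof -
      have "- 1 / m * real (m + 1) = - 1 / m - 1"
        using \<open>m > 0\<close> by (simp add: field_simps)
      moreover have "((1 + b * t) powr (- 1 / m)) ^ (m + 1) = (1 + b * t) powr (- 1 / m * real (m + 1))"
        using pos by (subst powr_power) (auto simp: mult.commute)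
      ultimately show ?thesis
        by simp
    qed
    then have "- \<eta> * (x0 * (1 + b * t) powr (- 1 / m)) ^ (m + 1) =
        x0 * (- 1 / m * (1 + b * t) powr (- 1 / m - 1) * b)"
      using assms by (simp add: power_mult_distrib b_def)
    moreover have "((\<lambda>t. x0 * (1 + b * t) powr (- 1 / m)) has_real_derivative
        x0 * (- 1 / m * (1 + b * t) powr (- 1 / m - 1) * b)) (at t within {0..})"
      using pos by (auto intro!: derivative_eq_intros)
    ultimately show ?thesis
      by simp
  qed
  then show ?thesis
    by (simp add: gradient_flow_power_loss_iff b_def)
qed

text \<open>The \<open>m\<close>-th power of any solution satisfies the Riccati equation. As
  \<open>m\<close> is even, the \<open>m\<close>-th root recovers only the absolute value, which is
  enough for a two-sided bound.\<close>

lemma gradient_flow_power_loss_abs: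
  assumes sol: "gradient_flow_solution \<eta> (power_loss (m + 2)) x0 x"
    and "m > 0" "even m" "\<eta> \<ge> 0" "t \<ge> 0"
  shows "\<bar>x t\<bar> = (x0 ^ m / (1 + m * \<eta> * x0 ^ m * t)) powr (1 / m)"
proof -
  have x: "x 0 = x0" "\<And>s. s \<ge> 0 \<Longrightarrow> (x has_real_derivative - \<eta> * x s ^ (m + 1)) (at s within {0..})"
    using sol by (auto simp: gradient_flow_power_loss_iff)
  have "((\<lambda>s. x s ^ m) has_real_derivative - (m * \<eta>) * (x s ^ m)\<^sup>2) (at s within {0..})"
    if "s \<ge> 0" for s
  proof -
    \<comment> \<open>The chain rule multiplies \<open>x s ^ (m - 1)\<close> by
      \<open>x s ^ (m + 1)\<close>; the exponents add up to \<open>2 * m\<close>.\<close>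
    have "x s * (x s ^ m * x s ^ (m - 1)) = (x s ^ m)\<^sup>2"
      using \<open>m > 0\<close> by (cases m) (simp_all add: power2_eq_square)
    then show ?thesis
      using x(2)[OF that]
      by (auto intro!: derivative_eq_intros)
  qed
  then have "x t ^ m = x0 ^ m / (1 + m * \<eta> * x0 ^ m * t)"
    using riccati_solution_unique[of "\<lambda>s. x s ^ m" "m * \<eta>" t] assms x(1)
    by (simp add: zero_le_even_power)
  moreover have "(x t ^ m) powr (1 / m) = \<bar>x t\<bar>"
  proof -
    have "x t ^ m = \<bar>x t\<bar> powr m"
      using assms by (cases "x t = 0") (simp_all add: powr_realpow power_even_abs)
    then show ?thesis
      using assms by (simp add: powr_powr)
  qed
  ultimately show ?thesis
    by simp
qed

theorem theorem5p1:
  fixes k :: nat and \<eta> x0 :: real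
  assumes "k \<ge> 4" and "even k" and "\<eta> > 0" and "x0 \<noteq> 0"
  shows "(\<exists>x. gradient_flow_solution \<eta> (power_loss k) x0 x) \<and>
         (\<forall>x. gradient_flow_solution \<eta> (power_loss k) x0 x \<longrightarrow>
              x \<in> \<Theta>[at_top](\<lambda>t. t powr (- 1 / (real k - 2))))"
proof -
  obtain m where k: "k = m + 2" and m: "m > 0" "even m"
  proof
    show "k = (k - 2) + 2" "k - 2 > 0" "even (k - 2)"
      using assms by auto
  qed
  have "x \<in> \<Theta>[at_top](\<lambda>t. t powr (- 1 / (real k - 2)))"
    if sol: "gradient_flow_solution \<eta> (power_loss k) x0 x" for x
  proof -
    define w b p where "w = x0 ^ m" and "b = m * \<eta> * x0 ^ m" and "p = 1 / real m"
    \<comment> \<open>Here \<open>x0 \<noteq> 0\<close> enters: for \<open>x0 = 0\<close> the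
      formula gives the zero solution, which has no lower bound of this order.\<close>
    have "w > 0"
      using assms m by (simp add: w_def zero_less_power_eq)
    then have "b > 0"
      using assms m by (simp add: b_def w_def)
    \<comment> \<open>The base behaves like \<open>(w / b) / t\<close> with
      \<open>w / b > 0\<close>.\<close>
    have "(\<lambda>t. (w / (1 + b * t)) powr p) \<in> \<Theta>(\<lambda>t. t powr - p)"
      using \<open>w > 0\<close> \<open>b > 0\<close> by real_asymp
    moreover have "eventually (\<lambda>t. \<bar>x t\<bar> = (w / (1 + b * t)) powr p) at_top"
      using eventually_ge_at_top[of 0]
      by (rule eventually_mono)
        (use gradient_flow_power_loss_abs[OF sol[unfolded k] m] assms in
          \<open>simp add: w_def b_def p_def\<close>)
    ultimately have "(\<lambda>t. \<bar>x t\<bar>) \<in> \<Theta>(\<lambda>t. t powr - p)"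
      by (subst landau_theta.in_cong)
    then show ?thesis
      by (simp add: p_def k)
  qed
  moreover have "\<exists>x. gradient_flow_solution \<eta> (power_loss k) x0 x"
    using gradient_flow_power_loss_exists[of m \<eta> x0] assms m k by auto
  ultimately show ?thesis
    by blast
qed

end
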